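(* Let $\mathcal{H}\subseteq\mathcal{K}$ be complex Hilbert spaces, let $T\in\mathcal{B}(\mathcal{H})$ be a contraction and let $W\in\mathcal{B}(\mathcal{K})$ be a co-isometric extension of $T$. Let $X\in\mathcal{B}(\mathcal{H})$. Let $Q\in\mathcal{B}(\mathcal{H})$ and $\overline{Q}\in\mathcal{B}(\mathcal{K})$ be contractions such that $\mathcal{H}$ reduces $\overline{Q}$ and $\overline{Q}|_{\mathcal{H}}=Q$. (i) If $XTQ=TX$, then there exists an extension $Y\in\mathcal{B}(\mathcal{K})$ of $X$ such that $YW\overline{Q}=WY$. (ii) If $XQT=TX$, then there exists an extension $Y\in\mathcal{B}(\mathcal{K})$ of $X$ such that $Y\overline{Q}W=WY$. (iii) If moreover $Q$ and $\overline{Q}$ are unitary and $QXT=TX$, then there exists an extension $Y\in\mathcal{B}(\mathcal{K})$ of $X$ such that $\overline{Q}YW=WY$. In all cases $T^nX^m=P_{\mathcal{H}}W^nY^m|_{\mathcal{H}}$ and $X^nT^m=P_{\mathcal{H}}Y^nW^m|_{\mathcal{H}}$ for all integers $n,m\geq 0$, and $Y$ can be chosen such that $\|Y\|=\|X\|$.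
   Context: For Hilbert spaces $\mathcal{H}\subseteq\mathcal{K}$, $S\in\mathcal{B}(\mathcal{K})$ is an extension of $T\in\mathcal{B}(\mathcal{H})$ if $S h=Th$ for all $h\in\mathcal{H}$; a co-isometric extension is an extension $W$ with $WW^*=I$. $P_{\mathcal{H}}$ is the orthogonal projection onto $\mathcal{H}$. *)

theory Defs
  imports "HOL-Analysis.Analysis"
begin

text \<open>A complex Hilbert space, encoded as a real Hilbert space together with the
  operator of multiplication by the imaginary unit (an orthogonal complex structure).
  Complex scalar multiplication and the complex inner product are derived from it.\<close>

class complex_hilbert = real_inner + complete_space +
  fixes imult :: "'a \<Rightarrow> 'a"
  assumes imult_add: "imult (x + y) = imult x + imult y"
    and imult_scaleR: "imult (r *\<^sub>R x) = r *\<^sub>R imult x"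
    and imult_imult: "imult (imult x) = - x"
    and inner_imult: "inner (imult x) (imult y) = inner x y"

definition scaleC :: "complex \<Rightarrow> 'a::complex_hilbert \<Rightarrow> 'a" (infixr "*\<^sub>C" 75) where
  "c *\<^sub>C x = Re c *\<^sub>R x + Im c *\<^sub>R imult x"

text \<open>Complex inner product, conjugate-linear in the first and linear in the second argument.\<close>
definition cinner :: "'a::complex_hilbert \<Rightarrow> 'a \<Rightarrow> complex" where
  "cinner x y = Complex (inner x y) (- inner x (imult y))"

definition csubspace :: "'a::complex_hilbert set \<Rightarrow> bool" where
  "csubspace H \<longleftrightarrow> 0 \<in> H \<and> (\<forall>x\<in>H. \<forall>y\<in>H. x + y \<in> H) \<and> (\<forall>c. \<forall>x\<in>H. c *\<^sub>C x \<in> H)"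

definition hilbert_subspace :: "'a::complex_hilbert set \<Rightarrow> bool" where
  "hilbert_subspace H \<longleftrightarrow> csubspace H \<and> closed H"

text \<open>A bounded complex-linear operator on the subspace H (only its values on H matter).\<close>
definition bounded_op_on :: "'a::complex_hilbert set \<Rightarrow> ('a \<Rightarrow> 'a) \<Rightarrow> bool" where
  "bounded_op_on H A \<longleftrightarrow>
     (\<forall>x\<in>H. A x \<in> H) \<and>
     (\<forall>x\<in>H. \<forall>y\<in>H. A (x + y) = A x + A y) \<and>
     (\<forall>c. \<forall>x\<in>H. A (c *\<^sub>C x) = c *\<^sub>C A x) \<and>
     (\<exists>C. \<forall>x\<in>H. norm (A x) \<le> C * norm x)"

definition opnorm_on :: "'a::complex_hilbert set \<Rightarrow> ('a \<Rightarrow> 'a) \<Rightarrow> real" where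
  "opnorm_on H A = Sup ((\<lambda>x. norm (A x)) ` {x\<in>H. norm x \<le> 1})"

definition contraction_on :: "'a::complex_hilbert set \<Rightarrow> ('a \<Rightarrow> 'a) \<Rightarrow> bool" where
  "contraction_on H A \<longleftrightarrow> bounded_op_on H A \<and> (\<forall>x\<in>H. norm (A x) \<le> norm x)"

definition unitary_on :: "'a::complex_hilbert set \<Rightarrow> ('a \<Rightarrow> 'a) \<Rightarrow> bool" where
  "unitary_on H A \<longleftrightarrow> bounded_op_on H A \<and> A ` H = H \<and>
     (\<forall>x\<in>H. \<forall>y\<in>H. cinner (A x) (A y) = cinner x y)"

definition coisometry :: "('a::complex_hilbert \<Rightarrow> 'a) \<Rightarrow> bool" where
  "coisometry W \<longleftrightarrow> (\<exists>Ws. bounded_op_on UNIV Ws \<and>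
      (\<forall>x y. cinner (W x) y = cinner x (Ws y)) \<and> (\<forall>x. W (Ws x) = x))"

definition orth_compl :: "'a::complex_hilbert set \<Rightarrow> 'a set" where
  "orth_compl H = {y. \<forall>h\<in>H. cinner h y = 0}"

definition reduces :: "'a::complex_hilbert set \<Rightarrow> ('a \<Rightarrow> 'a) \<Rightarrow> bool" where
  "reduces H A \<longleftrightarrow> (\<forall>x\<in>H. A x \<in> H) \<and> (\<forall>x\<in>orth_compl H. A x \<in> orth_compl H)"

definition proj :: "'a::complex_hilbert set \<Rightarrow> 'a \<Rightarrow> 'a" where
  "proj H x = (SOME p. p \<in> H \<and> x - p \<in> orth_compl H)"

definition extends_on :: "'a::complex_hilbert set \<Rightarrow> ('a \<Rightarrow> 'a) \<Rightarrow> ('a \<Rightarrow> 'a) \<Rightarrow> bool" where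
  "extends_on H S A \<longleftrightarrow> (\<forall>h\<in>H. S h = A h)"

end

theory Submission
  imports Defs
begin

text \<open>All three parts are instances of one statement: if \<open>A\<close> is a contraction leaving \<open>H\<close>
  invariant, \<open>W\<close> is a coisometry and \<open>X A = W X\<close> on \<open>H\<close>, then \<open>X\<close> extends to \<open>Y\<close> with \<open>Y A = W Y\<close>
  and the same norm. Take \<open>A = W Qb\<close> in (i), \<open>A = Qb W\<close> in (ii), and \<open>A = W\<close> with the coisometry
  \<open>Qb\<^sup>* W\<close> in (iii).

  No dilation space is needed. Let \<open>Y\<^sub>n\<close> be an extension of \<open>X\<close> of norm at most \<open>c = \<parallel>X\<parallel>\<close>, put
  \<open>R = Y\<^sub>n A\<close> and let \<open>d > c\<close>. An extension \<open>Y'\<close> with \<open>W Y' = R\<close> and norm at most \<open>d\<close> has the form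
  \<open>W\<^sup>* R + Z\<close>, where \<open>Z\<close> maps into \<open>ker W\<close>, equals \<open>X - W\<^sup>* W X\<close> on \<open>H\<close> and is dominated by the
  form \<open>d\<^sup>2 \<langle>x, y\<rangle> - \<langle>R x, R y\<rangle>\<close>. This form is coercive, so one may take \<open>(X - W\<^sup>* W X) P\<close> for \<open>Z\<close>,
  with \<open>P\<close> the projection onto \<open>H\<close> that is orthogonal for the form. Weak compactness lets \<open>d\<close>
  decrease to \<open>c\<close>, which gives \<open>Y\<^sub>n\<^sub>+\<^sub>1\<close> with \<open>W Y\<^sub>n\<^sub>+\<^sub>1 = Y\<^sub>n A\<close>; a weak cluster point of the Cesaro
  means of the \<open>Y\<^sub>n\<close> is the required \<open>Y\<close>. The argument runs over the reals; averaging over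
  multiplication by \<open>\<i>\<close> makes \<open>Y\<close> complex-linear.\<close>

section \<open>Projections with respect to a coercive form\<close>

lemma linear_coeff_eq_0_if_quadratic_nonneg:
  fixes a b :: real
  assumes "\<And>t. 0 \<le> t\<^sup>2 * a + t * b" and "a \<ge> 0"
  shows "b = 0"
proof -
  have "0 \<le> (- b / (a + 1))\<^sup>2 * a + (- b / (a + 1)) * b" by (rule assms(1))
  also have "\<dots> = - (b\<^sup>2 / (a + 1)\<^sup>2)"
    using assms(2) by (simp add: power2_eq_square divide_simps) (simp add: algebra_simps)
  finally show ?thesis using assms(2) by (simp add: divide_le_0_iff)
qed

locale coercive_form = bounded_bilinear g for g :: "'a::banach \<Rightarrow> 'a \<Rightarrow> real" +
  fixes \<alpha> :: real
  assumes symmetric: "g x y = g y x"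
    and \<alpha>_pos: "\<alpha> > 0"
    and coercive: "\<alpha> * (norm x)\<^sup>2 \<le> g x x"
begin

lemma nonneg: "0 \<le> g x x"
  using coercive[of x] \<alpha>_pos by (meson less_imp_le order_trans zero_le_mult_iff zero_le_power2)

definition energy :: "('a \<Rightarrow> real) \<Rightarrow> 'a \<Rightarrow> real" where
  "energy f u = g u u - 2 * f u"

lemma bdd_below_energy:
  assumes "bounded_linear f"
  shows "bdd_below (range (energy f))"
proof -
  obtain K where K: "\<And>u. \<bar>f u\<bar> \<le> norm u * K"
    using bounded_linear.bounded[OF assms] unfolding real_norm_def by blast
  have "- (K\<^sup>2 / \<alpha>) \<le> energy f u" for u
  proof -
    have "0 \<le> (\<alpha> * norm u - K)\<^sup>2" by simp
    also have "\<dots> = \<alpha> * (\<alpha> * (norm u)\<^sup>2 - 2 * (norm u * K)) + K\<^sup>2"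
      by (simp add: power2_eq_square algebra_simps)
    also have "\<dots> \<le> \<alpha> * energy f u + K\<^sup>2"
      using coercive[of u] K[of u] \<alpha>_pos by (simp add: energy_def mult_left_mono)
    finally show ?thesis using \<alpha>_pos by (simp add: field_simps)
  qed
  then show ?thesis by (rule bdd_belowI2)
qed

lemma energy_parallelogram:
  assumes "linear f"
  shows "g (u - v) (u - v) =
    2 * energy f u + 2 * energy f v - 4 * energy f ((1/2) *\<^sub>R (u + v))"
  by (simp add: energy_def linear_add[OF assms] linear_scale[OF assms] scaleR_left scaleR_right
      add_left add_right diff_left diff_right symmetric[of v u] field_simps)

lemma dist_le_energy_excess:
  assumes f: "linear f" and S: "convex S" and m: "\<And>s. s \<in> S \<Longrightarrow> m \<le> energy f s"
    and u: "u \<in> S" and v: "v \<in> S"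
  shows "\<alpha> * (dist u v)\<^sup>2 \<le> 2 * (energy f u - m) + 2 * (energy f v - m)"
proof -
  have midpoint: "(1/2) *\<^sub>R (u + v) \<in> S"
    using convexD[OF S u v, of "1/2" "1/2"] by (simp add: scaleR_add_right)
  have "g (u - v) (u - v) \<le> 2 * (energy f u - m) + 2 * (energy f v - m)"
    using m[OF midpoint] energy_parallelogram[OF f, of u v] by (simp add: algebra_simps)
  with coercive[of "u - v"] show ?thesis by (simp add: dist_norm)
qed

lemma Cauchy_energy_minimizing_sequence:
  assumes f: "linear f" and S: "convex S" and m: "\<And>s. s \<in> S \<Longrightarrow> m \<le> energy f s"
    and u: "\<And>n. u n \<in> S" and lim: "(\<lambda>n. energy f (u n)) \<longlonglongrightarrow> m"
  shows "Cauchy u"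
proof (rule metric_CauchyI)
  fix e :: real
  assume e: "e > 0"
  then have "\<forall>\<^sub>F n in sequentially. energy f (u n) < m + \<alpha> * e\<^sup>2 / 4"
    using \<alpha>_pos by (intro order_tendstoD[OF lim]) simp
  then obtain N where N: "\<And>n. n \<ge> N \<Longrightarrow> energy f (u n) < m + \<alpha> * e\<^sup>2 / 4"
    by (auto simp: eventually_sequentially)
  have "dist (u i) (u j) < e" if "i \<ge> N" "j \<ge> N" for i j
  proof -
    have "\<alpha> * (dist (u i) (u j))\<^sup>2 \<le> 2 * (energy f (u i) - m) + 2 * (energy f (u j) - m)"
      using f S m u u by (rule dist_le_energy_excess)
    then have "\<alpha> * (dist (u i) (u j))\<^sup>2 < \<alpha> * e\<^sup>2"
      using N[OF that(1)] N[OF that(2)] by (simp add: algebra_simps)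
    with \<alpha>_pos e show ?thesis by (simp add: power2_less_imp_less)
  qed
  then show "\<exists>N. \<forall>i\<ge>N. \<forall>j\<ge>N. dist (u i) (u j) < e" by blast
qed

lemma energy_minimizer_exists:
  assumes f: "bounded_linear f" and S: "closed S" "convex S" "S \<noteq> {}"
  obtains u where "u \<in> S" "\<And>v. v \<in> S \<Longrightarrow> energy f u \<le> energy f v"
proof -
  define m where "m = Inf (energy f ` S)"
  have bdd: "bdd_below (energy f ` S)"
    by (rule bdd_below_mono[OF bdd_below_energy[OF f]]) auto
  have m_le: "m \<le> energy f s" if "s \<in> S" for s
    unfolding m_def using that by (intro cInf_lower bdd imageI)
  have "\<exists>u\<in>S. energy f u < m + 1 / real (Suc n)" for n
    using cInf_less_iff[OF _ bdd, of "m + 1 / real (Suc n)"] S(3) by (simp add: m_def)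
  then obtain u where u: "\<And>n. u n \<in> S" "\<And>n. energy f (u n) < m + 1 / real (Suc n)"
    by metis
  have lim: "(\<lambda>n. energy f (u n)) \<longlonglongrightarrow> m"
  proof (rule tendsto_sandwich)
    show "\<forall>\<^sub>F n in sequentially. m \<le> energy f (u n)"
      "\<forall>\<^sub>F n in sequentially. energy f (u n) \<le> m + 1 / real (Suc n)"
      using m_le u by (simp_all add: less_imp_le del: of_nat_Suc)
    show "(\<lambda>n. m + 1 / real (Suc n)) \<longlonglongrightarrow> m"
      using tendsto_add[OF tendsto_const LIMSEQ_Suc[OF lim_1_over_n]] by simp
  qed simp
  have "Cauchy u"
    using bounded_linear.linear[OF f] S(2) m_le u(1) lim by (rule Cauchy_energy_minimizing_sequence)
  then obtain l where l: "u \<longlonglongrightarrow> l" by (auto simp: Cauchy_convergent_iff convergent_def)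
  have "(\<lambda>n. energy f (u n)) \<longlonglongrightarrow> energy f l"
    unfolding energy_def by (intro tendsto_intros tendsto bounded_linear.tendsto[OF f] l)
  with lim have "energy f l = m" by (rule LIMSEQ_unique[symmetric])
  moreover have "l \<in> S" using S(1) u(1) l by (rule closed_sequentially)
  ultimately show thesis using that m_le by simp
qed

theorem Lax_Milgram_subspace:
  assumes f: "bounded_linear f" and S: "subspace S" "closed S"
  shows "\<exists>!u. u \<in> S \<and> (\<forall>s\<in>S. g u s = f s)"
proof (rule ex_ex1I)
  interpret f: bounded_linear f by (rule f)
  obtain u where u: "u \<in> S" and min: "\<And>v. v \<in> S \<Longrightarrow> energy f u \<le> energy f v"
    using energy_minimizer_exists[OF f S(2) subspace_imp_convex[OF S(1)]] subspace_0[OF S(1)]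
    by blast
  have "g u s = f s" if s: "s \<in> S" for s
  proof -
    have "0 \<le> t\<^sup>2 * g s s + t * (2 * (g u s - f s))" for t
    proof -
      have "u + t *\<^sub>R s \<in> S" using S(1) u s by (simp add: subspace_add subspace_scale)
      then have "energy f u \<le> energy f (u + t *\<^sub>R s)" by (rule min)
      then show ?thesis
        by (simp add: energy_def add_left add_right scaleR_left scaleR_right f.add f.scaleR
            symmetric[of s u] power2_eq_square algebra_simps)
    qed
    then have "2 * (g u s - f s) = 0"
      by (rule linear_coeff_eq_0_if_quadratic_nonneg) (rule nonneg)
    then show ?thesis by simp
  qed
  with u show "\<exists>u. u \<in> S \<and> (\<forall>s\<in>S. g u s = f s)" by blast
next
  fix u v
  assume "u \<in> S \<and> (\<forall>s\<in>S. g u s = f s)" "v \<in> S \<and> (\<forall>s\<in>S. g v s = f s)"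
  then have "g (u - v) (u - v) = 0"
    using subspace_diff[OF S(1)] by (simp add: diff_left)
  then show "u = v" using coercive[of "u - v"] \<alpha>_pos by (simp add: mult_le_0_iff)
qed

theorem linear_projection_exists:
  assumes S: "subspace S" "closed S"
  obtains P where "linear P" "\<And>x. P x \<in> S" "\<And>x. x \<in> S \<Longrightarrow> P x = x"
    "\<And>x. g (P x) (P x) \<le> g x x"
proof -
  note unique_ex = Lax_Milgram_subspace[OF bounded_linear_right S]
  obtain P where PS: "\<And>x. P x \<in> S" and P: "\<And>x s. s \<in> S \<Longrightarrow> g (P x) s = g x s"
    using unique_ex by metis
  have P_eqI: "P x = u" if "u \<in> S" "\<And>s. s \<in> S \<Longrightarrow> g u s = g x s" for x u
    using unique_ex[of x] PS[of x] P[of _ x] that by blast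
  show thesis
  proof
    show "linear P"
    proof (rule linearI)
      show "P (x + y) = P x + P y" for x y
        by (rule P_eqI) (simp_all add: subspace_add[OF S(1)] PS P add_left)
      show "P (r *\<^sub>R x) = r *\<^sub>R P x" for r x
        by (rule P_eqI) (simp_all add: subspace_scale[OF S(1)] PS P scaleR_left)
    qed
    show "P x = x" if "x \<in> S" for x using that by (rule P_eqI) simp
    show "g (P x) (P x) \<le> g x x" for x
    proof -
      have "g (x - P x) (x - P x) = g x x - g (P x) (P x)"
        using P[OF PS[of x], of x] by (simp add: diff_left diff_right symmetric[of "P x" x])
      then show ?thesis using nonneg[of "x - P x"] by simp
    qed
  qed (rule PS)
qed

corollary dominated_extension_exists:
  fixes F :: "'a \<Rightarrow> 'b::real_normed_vector"
  assumes S: "subspace S" "closed S" and F: "linear F"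
    and dominated: "\<And>s. s \<in> S \<Longrightarrow> (norm (F s))\<^sup>2 \<le> g s s"
  shows "\<exists>Z. linear Z \<and> (\<forall>s\<in>S. Z s = F s) \<and> (\<forall>x. Z x \<in> F ` S) \<and> (\<forall>x. (norm (Z x))\<^sup>2 \<le> g x x)"
proof -
  obtain P where P: "linear P" "\<And>x. P x \<in> S" "\<And>s. s \<in> S \<Longrightarrow> P s = s"
    "\<And>x. g (P x) (P x) \<le> g x x"
    using linear_projection_exists[OF S] by blast
  have "linear (F \<circ> P)" using P(1) F by (rule linear_compose)
  moreover have "(norm (F (P x)))\<^sup>2 \<le> g x x" for x
    using dominated[OF P(2)] P(4) by (rule order_trans)
  ultimately show ?thesis using P(2,3) by (intro exI[of _ "F \<circ> P"]) simp
qed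

end

interpretation inner: coercive_form "(\<bullet>) :: 'a::{real_inner,banach} \<Rightarrow> 'a \<Rightarrow> real" 1
  by (intro coercive_form.intro coercive_form_axioms.intro bounded_bilinear_inner)
    (simp_all add: inner_commute power2_norm_eq_inner)

section \<open>Weak compactness of balls of operators\<close>

lemma Riesz_representation:
  fixes f :: "'a::{real_inner,banach} \<Rightarrow> real"
  assumes "bounded_linear f"
  shows "\<exists>z. \<forall>x. f x = z \<bullet> x"
  using inner.Lax_Milgram_subspace[OF assms subspace_UNIV closed_UNIV] by (metis UNIV_I)

lemma norm_le_if_inner_self_le:
  fixes a :: "'a::real_inner"
  assumes "a \<bullet> a \<le> k * norm a" "k \<ge> 0"
  shows "norm a \<le> k"
  using assms by (cases "a = 0") (simp_all add: power2_eq_square flip: power2_norm_eq_inner)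

definition operator_ball :: "real \<Rightarrow> ('a::real_normed_vector \<Rightarrow> 'b::real_normed_vector) set" where
  "operator_ball c = {A. bounded_linear A \<and> (\<forall>x. norm (A x) \<le> c * norm x)}"

lemma operator_ballI:
  assumes "linear A" "\<And>x. norm (A x) \<le> c * norm x"
  shows "A \<in> operator_ball c"
proof -
  have "bounded_linear A"
    using assms(2)
    by (intro bounded_linear_intro[of _ c])
      (simp_all add: linear_add[OF assms(1)] linear_scale[OF assms(1)] mult.commute)
  with assms(2) show ?thesis by (simp add: operator_ball_def)
qed

lemma operator_ball_linear: "A \<in> operator_ball c \<Longrightarrow> linear A"
  by (simp add: operator_ball_def bounded_linear.linear)

lemma operator_ball_norm: "A \<in> operator_ball c \<Longrightarrow> norm (A x) \<le> c * norm x"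
  by (simp add: operator_ball_def)

lemma operator_ball_mono: "c \<le> d \<Longrightarrow> operator_ball c \<subseteq> operator_ball d"
  unfolding operator_ball_def by (blast intro: order_trans mult_right_mono norm_ge_zero)

lemma operator_ball_compose:
  assumes A: "A \<in> operator_ball c" and B: "B \<in> operator_ball d" and c: "c \<ge> 0"
  shows "(\<lambda>x. A (B x)) \<in> operator_ball (c * d)"
proof (rule operator_ballI)
  show "linear (\<lambda>x. A (B x))"
    using linear_compose[OF operator_ball_linear[OF B] operator_ball_linear[OF A]]
    by (simp add: o_def)
  have "norm (A (B x)) \<le> c * (d * norm x)" for x
    using operator_ball_norm[OF A, of "B x"] mult_left_mono[OF operator_ball_norm[OF B, of x] c]
    by linarith
  then show "norm (A (B x)) \<le> c * d * norm x" for x by (simp add: mult.assoc)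
qed

definition operator_form :: "('a \<Rightarrow> 'b::real_inner) \<Rightarrow> 'a \<Rightarrow> 'b \<Rightarrow> real" where
  "operator_form A x y = A x \<bullet> y"

lemma bilinear_operator_form:
  assumes "linear A"
  shows "bilinear (operator_form A)"
  unfolding bilinear_def
  by (intro conjI allI linearI)
    (simp_all add: operator_form_def linear_add[OF assms] linear_scale[OF assms]
      inner_add_left inner_add_right)

lemma abs_operator_form_le:
  assumes "A \<in> operator_ball c"
  shows "\<bar>operator_form A x y\<bar> \<le> c * norm x * norm y"
  using Cauchy_Schwarz_ineq2[of "A x" y]
    mult_right_mono[OF operator_ball_norm[OF assms, of x] norm_ge_zero[of y]]
  by (simp add: operator_form_def)

lemma bounded_bilinear_form_represented:
  fixes b :: "'a::real_normed_vector \<Rightarrow> 'b::{real_inner,banach} \<Rightarrow> real"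
  assumes b: "bilinear b" and bound: "\<And>x y. \<bar>b x y\<bar> \<le> c * norm x * norm y" and c: "c \<ge> 0"
  shows "b \<in> operator_form ` operator_ball c"
proof -
  have "\<exists>z. \<forall>y. b x y = z \<bullet> y" for x
  proof -
    have "bounded_linear (b x)"
      using bound
      by (intro bounded_linear_intro[of _ "c * norm x"])
        (simp_all add: bilinear_radd[OF b] bilinear_rmul[OF b] mult.commute)
    then show ?thesis by (rule Riesz_representation)
  qed
  then obtain A where A: "\<And>x y. b x y = A x \<bullet> y" by metis
  have "linear A"
  proof (rule linearI)
    show "A (x + y) = A x + A y" for x y
      by (rule vector_eq_rdot[THEN iffD1]) (simp add: inner_add_left bilinear_ladd[OF b] flip: A)
    show "A (r *\<^sub>R x) = r *\<^sub>R A x" for r x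
      by (rule vector_eq_rdot[THEN iffD1]) (simp add: bilinear_lmul[OF b] flip: A)
  qed
  moreover have "norm (A x) \<le> c * norm x" for x
    using bound[of x "A x"] c by (intro norm_le_if_inner_self_le) (simp_all add: A)
  ultimately have "A \<in> operator_ball c" by (rule operator_ballI)
  moreover have "b = operator_form A" by (intro ext) (simp add: operator_form_def A)
  ultimately show ?thesis by blast
qed

lemma compact_pointwise:
  fixes K :: "'i \<Rightarrow> 'b::topological_space set"
  assumes "\<And>i. compact (K i)"
  shows "compact {f. \<forall>i. f i \<in> K i}"
proof -
  have "compactin (product_topology (\<lambda>i. euclidean) UNIV) (PiE UNIV K)"
    unfolding compactin_PiE using assms by simp
  moreover have "PiE UNIV K = {f. \<forall>i. f i \<in> K i}" by (auto simp: PiE_def)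
  ultimately show ?thesis by (simp add: euclidean_product_topology)
qed

lemma continuous_on_apply2:
  "continuous_on UNIV (\<lambda>b :: 'a \<Rightarrow> 'b \<Rightarrow> 'c::topological_space. b x y)"
  by (rule continuous_on_product_then_coordinatewise[OF continuous_on_product_coordinates])

lemma closed_bilinear: "closed {b :: 'a::real_vector \<Rightarrow> 'b::real_vector \<Rightarrow> real. bilinear b}"
  unfolding bilinear_def linear_iff
  by (intro closed_Collect_conj closed_Collect_all closed_Collect_eq continuous_on_add
      continuous_on_mult_left continuous_on_scaleR continuous_on_const continuous_on_apply2)

lemma compact_operator_form_ball:
  assumes "c \<ge> 0"
  shows "compact (operator_form `
    (operator_ball c :: ('a::real_normed_vector \<Rightarrow> 'b::{real_inner,banach}) set))"
proof -
  let ?box = "{b :: 'a \<Rightarrow> 'b \<Rightarrow> real. \<forall>x. b x \<in> {f. \<forall>y. f y \<in> cball 0 (c * norm x * norm y)}}"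
  have "operator_form ` operator_ball c = ?box \<inter> {b. bilinear b}"
  proof (intro equalityI subsetI)
    fix b :: "'a \<Rightarrow> 'b \<Rightarrow> real"
    assume "b \<in> operator_form ` operator_ball c"
    then show "b \<in> ?box \<inter> {b. bilinear b}"
      by (auto simp: bilinear_operator_form operator_ball_linear abs_operator_form_le)
  next
    fix b :: "'a \<Rightarrow> 'b \<Rightarrow> real"
    assume "b \<in> ?box \<inter> {b. bilinear b}"
    then show "b \<in> operator_form ` operator_ball c"
      using assms by (intro bounded_bilinear_form_represented) auto
  qed
  moreover have "compact (?box \<inter> {b. bilinear b})"
    by (intro compact_Int_closed compact_pointwise compact_cball closed_bilinear)
  ultimately show ?thesis by simp
qed

lemma compact_cluster_point:
  fixes F :: "nat \<Rightarrow> 'a::topological_space"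
  assumes K: "compact K" and F: "\<And>n. F n \<in> K"
  shows "\<exists>l\<in>K. \<forall>C. closed C \<longrightarrow> (\<forall>\<^sub>F n in sequentially. F n \<in> C) \<longrightarrow> l \<in> C"
proof -
  have "filtermap F sequentially \<noteq> bot" by (simp add: filtermap_bot_iff)
  moreover have "\<forall>\<^sub>F x in filtermap F sequentially. x \<in> K" by (simp add: eventually_filtermap F)
  ultimately obtain l where l: "l \<in> K" and cluster: "inf (nhds l) (filtermap F sequentially) \<noteq> bot"
    using K unfolding compact_filter by blast
  have "l \<in> C" if C: "closed C" "\<forall>\<^sub>F n in sequentially. F n \<in> C" for C
  proof (rule ccontr)
    assume "l \<notin> C"
    then have "\<forall>\<^sub>F x in nhds l. x \<notin> C"
      using eventually_nhds_in_open[of "- C" l] C(1) by (simp add: open_Compl)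
    with C(2) have "\<forall>\<^sub>F x in inf (nhds l) (filtermap F sequentially). False"
      unfolding eventually_inf eventually_filtermap
      by (intro exI[of _ "\<lambda>x. x \<notin> C"] exI[of _ "\<lambda>x. x \<in> C"]) simp
    with cluster show False by (simp add: trivial_limit_def)
  qed
  with l show ?thesis by blast
qed

definition weak_cluster_point ::
  "(nat \<Rightarrow> 'a \<Rightarrow> 'b::real_inner) \<Rightarrow> ('a \<Rightarrow> 'b) \<Rightarrow> bool" where
  "weak_cluster_point A L \<longleftrightarrow>
     (\<forall>C. closed C \<longrightarrow> (\<forall>\<^sub>F n in sequentially. operator_form (A n) \<in> C) \<longrightarrow> operator_form L \<in> C)"

lemma weak_cluster_pointD:
  assumes "weak_cluster_point A L" "closed {b. P b}"
    and "\<forall>\<^sub>F n in sequentially. P (operator_form (A n))"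
  shows "P (operator_form L)"
  using assms(1)[unfolded weak_cluster_point_def, rule_format, of "{b. P b}"] assms(2,3) by simp

theorem weak_cluster_point_exists:
  fixes A :: "nat \<Rightarrow> 'a::real_normed_vector \<Rightarrow> 'b::{real_inner,banach}"
  assumes "c \<ge> 0" "\<And>n. A n \<in> operator_ball c"
  shows "\<exists>L\<in>operator_ball c. weak_cluster_point A L"
proof -
  have "operator_form (A n) \<in> operator_form ` operator_ball c" for n
    using assms(2) by (rule imageI)
  from compact_cluster_point[OF compact_operator_form_ball[OF assms(1)] this]
  show ?thesis unfolding weak_cluster_point_def by (simp only: bex_simps)
qed

lemma weak_cluster_point_inner_diff:
  assumes L: "weak_cluster_point A L" and lim: "(\<lambda>n. A n x \<bullet> y - A n u \<bullet> v) \<longlonglongrightarrow> k"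
  shows "L x \<bullet> y - L u \<bullet> v = k"
proof -
  have "\<bar>L x \<bullet> y - L u \<bullet> v - k\<bar> \<le> e" if "e > 0" for e
  proof -
    have "closed {b. \<bar>b x y - b u v - k\<bar> \<le> e}"
      by (intro closed_Collect_le continuous_on_rabs continuous_on_diff continuous_on_const
          continuous_on_apply2)
    moreover have "\<forall>\<^sub>F n in sequentially. \<bar>A n x \<bullet> y - A n u \<bullet> v - k\<bar> \<le> e"
      using tendstoD[OF lim that] by (rule eventually_mono) (simp add: dist_real_def)
    ultimately show ?thesis
      using weak_cluster_pointD[OF L, of "\<lambda>b. \<bar>b x y - b u v - k\<bar> \<le> e"]
      by (simp add: operator_form_def)
  qed
  then have "\<bar>L x \<bullet> y - L u \<bullet> v - k\<bar> \<le> 0" by (rule field_le_epsilon[of _ 0, simplified])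
  then show ?thesis by simp
qed

lemma weak_cluster_point_inner:
  assumes "weak_cluster_point A L" "(\<lambda>n. A n x \<bullet> y) \<longlonglongrightarrow> k"
  shows "L x \<bullet> y = k"
  using weak_cluster_point_inner_diff[OF assms(1), of x y x 0] assms(2) by simp

lemma weak_cluster_point_eq:
  assumes "weak_cluster_point A L" "\<And>n. A n x = z"
  shows "L x = z"
proof -
  have "L x \<bullet> y = z \<bullet> y" for y
    by (rule weak_cluster_point_inner[OF assms(1)]) (simp add: assms(2))
  then show ?thesis by (metis vector_eq_rdot)
qed

lemma weak_cluster_point_norm_le:
  assumes L: "weak_cluster_point A L" and k: "\<And>n. norm (A n x) \<le> k n" "k \<longlonglongrightarrow> K"
  shows "norm (L x) \<le> K"
proof (rule field_le_epsilon)
  fix e :: real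
  assume "e > 0"
  then have k_le: "\<forall>\<^sub>F n in sequentially. k n < K + e"
    by (intro order_tendstoD[OF k(2)]) simp
  show "norm (L x) \<le> K + e"
  proof (rule norm_le_if_inner_self_le)
    have "closed {b. b x (L x) \<le> (K + e) * norm (L x)}"
      by (intro closed_Collect_le continuous_on_const continuous_on_apply2)
    moreover have "\<forall>\<^sub>F n in sequentially. A n x \<bullet> L x \<le> (K + e) * norm (L x)"
      using k_le
    proof (rule eventually_mono)
      fix n
      assume "k n < K + e"
      then have "norm (A n x) * norm (L x) \<le> (K + e) * norm (L x)"
        using k(1)[of n] by (intro mult_right_mono) simp_all
      with norm_cauchy_schwarz show "A n x \<bullet> L x \<le> (K + e) * norm (L x)"
        by (rule order_trans)
    qed
    ultimately show "L x \<bullet> L x \<le> (K + e) * norm (L x)"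
      using weak_cluster_pointD[OF L, of "\<lambda>b. b x (L x) \<le> (K + e) * norm (L x)"]
      by (simp add: operator_form_def)
    have "0 \<le> k n" for n using k(1)[of n] norm_ge_zero order_trans by blast
    then have "0 \<le> K" by (intro LIMSEQ_le_const[OF k(2)]) blast
    with \<open>e > 0\<close> show "0 \<le> K + e" by simp
  qed
qed

section \<open>Intertwining extensions over the reals\<close>

lemma coercive_form_defect:
  fixes R :: "'a::{real_inner,banach} \<Rightarrow> 'b::real_inner"
  assumes R: "R \<in> operator_ball c" and c: "0 \<le> c" "c < d"
  shows "coercive_form (\<lambda>x y. d\<^sup>2 * (x \<bullet> y) - R x \<bullet> R y) (d\<^sup>2 - c\<^sup>2)"
proof (intro coercive_form.intro coercive_form_axioms.intro)
  note linear_R = operator_ball_linear[OF R]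
  show "bounded_bilinear (\<lambda>x y. d\<^sup>2 * (x \<bullet> y) - R x \<bullet> R y)"
  proof
    show "\<exists>K. \<forall>x y. norm (d\<^sup>2 * (x \<bullet> y) - R x \<bullet> R y) \<le> norm x * norm y * K"
    proof (intro exI allI)
      fix x y
      have "\<bar>R x \<bullet> R y\<bar> \<le> (c * norm x) * (c * norm y)"
        by (intro order_trans[OF Cauchy_Schwarz_ineq2] mult_mono operator_ball_norm[OF R])
          (use c in simp_all)
      moreover have "d\<^sup>2 * \<bar>x \<bullet> y\<bar> \<le> d\<^sup>2 * (norm x * norm y)"
        by (intro mult_left_mono Cauchy_Schwarz_ineq2) simp
      ultimately show "norm (d\<^sup>2 * (x \<bullet> y) - R x \<bullet> R y) \<le> norm x * norm y * (d\<^sup>2 + c\<^sup>2)"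
        using abs_triangle_ineq4[of "d\<^sup>2 * (x \<bullet> y)" "R x \<bullet> R y"]
        by (simp add: abs_mult power2_eq_square algebra_simps)
    qed
  qed (simp_all add: linear_add[OF linear_R] linear_scale[OF linear_R] inner_add_left
      inner_add_right algebra_simps)
  show "d\<^sup>2 * (x \<bullet> y) - R x \<bullet> R y = d\<^sup>2 * (y \<bullet> x) - R y \<bullet> R x" for x y
    by (simp add: inner_commute)
  show "0 < d\<^sup>2 - c\<^sup>2" using c by (simp add: power_strict_mono)
  show "(d\<^sup>2 - c\<^sup>2) * (norm x)\<^sup>2 \<le> d\<^sup>2 * (x \<bullet> x) - R x \<bullet> R x" for x
    using power_mono[OF operator_ball_norm[OF R, of x], of 2]
    by (simp add: power_mult_distrib algebra_simps flip: power2_norm_eq_inner)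
qed

locale real_coisometry =
  fixes W V :: "'b::{real_inner,banach} \<Rightarrow> 'b"
  assumes inner_W: "W x \<bullet> y = x \<bullet> V y"
    and W_V: "W (V x) = x"
begin

lemma linear_W: "linear W"
proof (rule linearI)
  show "W (x + y) = W x + W y" for x y
    by (rule vector_eq_rdot[THEN iffD1]) (simp add: inner_W inner_add_left)
  show "W (r *\<^sub>R x) = r *\<^sub>R W x" for r x
    by (rule vector_eq_rdot[THEN iffD1]) (simp add: inner_W)
qed

lemma linear_V: "linear V"
proof (rule linearI)
  show "V (x + y) = V x + V y" for x y
    by (rule vector_eq_ldot[THEN iffD1]) (simp add: inner_add_right flip: inner_W)
  show "V (r *\<^sub>R x) = r *\<^sub>R V x" for r x
    by (rule vector_eq_ldot[THEN iffD1]) (simp flip: inner_W)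
qed

lemma norm_V: "norm (V x) = norm x"
  using inner_W[of "V x" x] by (simp add: W_V norm_eq_sqrt_inner)

lemma norm_W_le: "norm (W x) \<le> norm x"
proof (rule norm_le_if_inner_self_le)
  show "W x \<bullet> W x \<le> norm x * norm (W x)"
    using norm_cauchy_schwarz[of x "V (W x)"] by (simp add: inner_W norm_V)
qed simp

lemma W_in_operator_ball: "W \<in> operator_ball 1"
  by (rule operator_ballI) (simp_all add: linear_W norm_W_le)

lemma norm_V_add_kernel:
  assumes "W z = 0"
  shows "(norm (V x + z))\<^sup>2 = (norm x)\<^sup>2 + (norm z)\<^sup>2"
proof -
  have "orthogonal (V x) z"
    using inner_W[of z x] assms by (simp add: orthogonal_def inner_commute)
  then show ?thesis by (simp add: norm_add_Pythagorean norm_V)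
qed

lemma W_diff_V_W: "W (x - V (W x)) = 0"
  by (simp add: linear_diff[OF linear_W] W_V)

lemma norm_diff_V_W: "(norm (x - V (W x)))\<^sup>2 = (norm x)\<^sup>2 - (norm (W x))\<^sup>2"
  using norm_V_add_kernel[OF W_diff_V_W, of "W x" x] by simp

lemma lift_through_coisometry_slack:
  fixes X R :: "'a::{real_inner,banach} \<Rightarrow> 'b"
  assumes H: "subspace H" "closed H" and c: "0 \<le> c" "c < d"
    and X: "X \<in> operator_ball c" and R: "R \<in> operator_ball c"
    and WX: "\<And>x. x \<in> H \<Longrightarrow> W (X x) = R x"
  shows "\<exists>Y\<in>operator_ball d. (\<forall>x\<in>H. Y x = X x) \<and> (\<forall>x. W (Y x) = R x)"
proof -
  define g where "g x y = d\<^sup>2 * (x \<bullet> y) - R x \<bullet> R y" for x y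
  interpret coercive_form g "d\<^sup>2 - c\<^sup>2"
    unfolding g_def by (rule coercive_form_defect[OF R c])
  have g_self: "g x x = (d * norm x)\<^sup>2 - (norm (R x))\<^sup>2" for x
    by (simp add: g_def power_mult_distrib power2_norm_eq_inner)
  define F where "F = (\<lambda>x. X x - V (W (X x)))"
  have "linear F"
    using linear_compose_sub[OF _ linear_compose[OF linear_compose[OF _ linear_W] linear_V]]
      operator_ball_linear[OF X]
    by (simp add: F_def o_def)
  moreover have "(norm (F x))\<^sup>2 \<le> g x x" if "x \<in> H" for x
  proof -
    have "norm (X x) \<le> d * norm x"
      using operator_ball_mono[of c d] X c(2) by (intro operator_ball_norm) auto
    then have "(norm (X x))\<^sup>2 \<le> (d * norm x)\<^sup>2" by (rule power_mono) simp
    moreover have "(norm (F x))\<^sup>2 = (norm (X x))\<^sup>2 - (norm (R x))\<^sup>2"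
      using norm_diff_V_W[of "X x"] by (simp add: F_def WX[OF that])
    ultimately show ?thesis by (simp add: g_self)
  qed
  ultimately obtain Z where "linear Z" and Z_F: "\<And>x. x \<in> H \<Longrightarrow> Z x = F x"
    and Z_in: "\<And>x. Z x \<in> F ` H" and norm_Z: "\<And>x. (norm (Z x))\<^sup>2 \<le> g x x"
    using dominated_extension_exists[OF H] by blast
  have W_Z: "W (Z x) = 0" for x using Z_in[of x] by (auto simp: F_def W_diff_V_W)
  show ?thesis
  proof (intro bexI conjI ballI allI operator_ballI)
    show "linear (\<lambda>x. V (R x) + Z x)"
      using linear_compose_add[OF linear_compose[OF operator_ball_linear[OF R] linear_V] \<open>linear Z\<close>]
      by (simp add: o_def)
    show "norm (V (R x) + Z x) \<le> d * norm x" for x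
      by (rule power2_le_imp_le)
        (use norm_Z[of x] c in \<open>simp_all add: norm_V_add_kernel W_Z g_self\<close>)
    show "V (R x) + Z x = X x" if "x \<in> H" for x using that by (simp add: Z_F F_def WX)
    show "W (V (R x) + Z x) = R x" for x by (simp add: linear_add[OF linear_W] W_V W_Z)
  qed
qed

theorem lift_through_coisometry:
  fixes X R :: "'a::{real_inner,banach} \<Rightarrow> 'b"
  assumes H: "subspace H" "closed H" and c: "0 \<le> c"
    and X: "X \<in> operator_ball c" and R: "R \<in> operator_ball c"
    and WX: "\<And>x. x \<in> H \<Longrightarrow> W (X x) = R x"
  shows "\<exists>Y\<in>operator_ball c. (\<forall>x\<in>H. Y x = X x) \<and> (\<forall>x. W (Y x) = R x)"
proof -
  define \<epsilon> where "\<epsilon> n = 1 / real (Suc n)" for n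
  have \<epsilon>: "0 < \<epsilon> n" "\<epsilon> n \<le> 1" for n by (simp_all add: \<epsilon>_def)
  have "\<exists>Y\<in>operator_ball (c + \<epsilon> n). (\<forall>x\<in>H. Y x = X x) \<and> (\<forall>x. W (Y x) = R x)" for n
    using \<epsilon> by (intro lift_through_coisometry_slack[OF H c _ X R WX]) simp
  then obtain Y where Y: "\<And>n. Y n \<in> operator_ball (c + \<epsilon> n)"
    and YX: "\<And>n x. x \<in> H \<Longrightarrow> Y n x = X x" and WY: "\<And>n x. W (Y n x) = R x"
    by metis
  have "Y n \<in> operator_ball (c + 1)" for n
    using Y operator_ball_mono[of "c + \<epsilon> n" "c + 1"] \<epsilon>(2) by auto
  then obtain L where L: "L \<in> operator_ball (c + 1)" "weak_cluster_point Y L"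
    using weak_cluster_point_exists[of "c + 1" Y] c by auto
  have "norm (L x) \<le> c * norm x" for x
  proof (rule weak_cluster_point_norm_le[OF L(2)])
    show "norm (Y n x) \<le> (c + \<epsilon> n) * norm x" for n using Y by (rule operator_ball_norm)
    have "(\<lambda>n. c + \<epsilon> n) \<longlonglongrightarrow> c + 0"
      unfolding \<epsilon>_def by (intro tendsto_add tendsto_const LIMSEQ_Suc[OF lim_1_over_n])
    then show "(\<lambda>n. (c + \<epsilon> n) * norm x) \<longlonglongrightarrow> c * norm x"
      by (intro tendsto_mult_right) simp
  qed
  with operator_ball_linear[OF L(1)] have "L \<in> operator_ball c" by (rule operator_ballI)
  moreover have "L x = X x" if "x \<in> H" for x
    using L(2) YX[OF that] by (rule weak_cluster_point_eq)
  moreover have "W (L x) = R x" for x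
  proof -
    have "L x \<bullet> V y = R x \<bullet> y" for y
      by (rule weak_cluster_point_inner[OF L(2)]) (simp add: WY flip: inner_W)
    then show ?thesis by (metis inner_W vector_eq_rdot)
  qed
  ultimately show ?thesis by blast
qed

end

definition cesaro_mean :: "(nat \<Rightarrow> 'a \<Rightarrow> 'b::real_vector) \<Rightarrow> nat \<Rightarrow> 'a \<Rightarrow> 'b" where
  "cesaro_mean Y N x = (1 / real (Suc N)) *\<^sub>R (\<Sum>n\<le>N. Y n x)"

lemma cesaro_mean_in_operator_ball:
  assumes "\<And>n. Y n \<in> operator_ball c"
  shows "cesaro_mean Y N \<in> operator_ball c"
proof (rule operator_ballI)
  show "linear (cesaro_mean Y N)"
    unfolding cesaro_mean_def
    by (intro linear_compose_scale_right linear_compose_sum ballI operator_ball_linear[OF assms])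
  have "norm (\<Sum>n\<le>N. Y n x) \<le> (\<Sum>n\<le>N. c * norm x)" for x
    by (intro sum_norm_le operator_ball_norm[OF assms])
  then show "norm (cesaro_mean Y N x) \<le> c * norm x" for x
    by (simp add: cesaro_mean_def field_simps)
qed

lemma cesaro_mean_const: "(\<And>n. Y n x = z) \<Longrightarrow> cesaro_mean Y N x = z"
  by (simp add: cesaro_mean_def sum_constant_scaleR)

context real_coisometry
begin

lemma norm_cesaro_mean_commutator_le:
  assumes Y: "\<And>n. Y n \<in> operator_ball c" and A: "A \<in> operator_ball 1" and c: "c \<ge> 0"
    and step: "\<And>n x. W (Y (Suc n) x) = Y n (A x)"
  shows "norm (W (cesaro_mean Y N x) - cesaro_mean Y N (A x)) \<le> 2 * c * norm x * (1 / real (Suc N))"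
proof -
  have "W (\<Sum>n\<le>N. Y n x) - (\<Sum>n\<le>N. Y n (A x)) = W (Y 0 x) - Y N (A x)"
    by (induction N) (simp_all add: linear_add[OF linear_W] step algebra_simps)
  then have commutator: "W (cesaro_mean Y N x) - cesaro_mean Y N (A x) =
      (1 / real (Suc N)) *\<^sub>R (W (Y 0 x) - Y N (A x))"
    by (simp only: cesaro_mean_def linear_scale[OF linear_W] flip: scaleR_diff_right)
  have "norm (W (Y 0 x)) \<le> c * norm x" "norm (Y N (A x)) \<le> c * norm x"
    using operator_ball_norm[OF operator_ball_compose[OF W_in_operator_ball Y[of 0]], of x]
      operator_ball_norm[OF operator_ball_compose[OF Y[of N] A c], of x] by simp_all
  then have "norm (W (Y 0 x) - Y N (A x)) \<le> 2 * c * norm x"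
    using norm_triangle_ineq4[of "W (Y 0 x)" "Y N (A x)"] by linarith
  then show ?thesis by (simp add: commutator divide_right_mono)
qed

lemma lifting_sequence_exists:
  fixes X :: "'a::{real_inner,banach} \<Rightarrow> 'b"
  assumes H: "subspace H" "closed H" and c: "c \<ge> 0" and X: "X \<in> operator_ball c"
    and A: "A \<in> operator_ball 1" "\<And>x. x \<in> H \<Longrightarrow> A x \<in> H"
    and XA: "\<And>x. x \<in> H \<Longrightarrow> X (A x) = W (X x)"
  shows "\<exists>Y. \<forall>n. (Y n \<in> operator_ball c \<and> (\<forall>x\<in>H. Y n x = X x)) \<and> (\<forall>x. W (Y (Suc n) x) = Y n (A x))"
proof (rule dependent_nat_choice)
  show "\<exists>Y. Y \<in> operator_ball c \<and> (\<forall>x\<in>H. Y x = X x)" using X by blast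
next
  fix Y and n :: nat
  assume Y: "Y \<in> operator_ball c \<and> (\<forall>x\<in>H. Y x = X x)"
  then have "(\<lambda>x. Y (A x)) \<in> operator_ball c"
    using operator_ball_compose[OF _ A(1) c, of Y] by simp
  moreover have "W (X x) = Y (A x)" if "x \<in> H" for x using that Y A(2) XA by simp
  ultimately show "\<exists>Y'. (Y' \<in> operator_ball c \<and> (\<forall>x\<in>H. Y' x = X x)) \<and> (\<forall>x. W (Y' x) = Y (A x))"
    using lift_through_coisometry[OF H c X, of "\<lambda>x. Y (A x)"] by blast
qed

theorem intertwining_extension:
  fixes X :: "'a::{real_inner,banach} \<Rightarrow> 'b"
  assumes H: "subspace H" "closed H" and c: "c \<ge> 0" and X: "X \<in> operator_ball c"
    and A: "A \<in> operator_ball 1" "\<And>x. x \<in> H \<Longrightarrow> A x \<in> H"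
    and XA: "\<And>x. x \<in> H \<Longrightarrow> X (A x) = W (X x)"
  shows "\<exists>Y\<in>operator_ball c. (\<forall>x\<in>H. Y x = X x) \<and> (\<forall>x. Y (A x) = W (Y x))"
proof -
  obtain Y where Y: "\<And>n. Y n \<in> operator_ball c" and YX: "\<And>n x. x \<in> H \<Longrightarrow> Y n x = X x"
    and step: "\<And>n x. W (Y (Suc n) x) = Y n (A x)"
    using lifting_sequence_exists[OF H c X A XA] by metis
  let ?C = "cesaro_mean Y"
  obtain L where L: "L \<in> operator_ball c" "weak_cluster_point ?C L"
    using weak_cluster_point_exists[of c ?C] c cesaro_mean_in_operator_ball[OF Y] by auto
  have "L x = X x" if "x \<in> H" for x
    using L(2) cesaro_mean_const[of Y, OF YX[OF that]] by (rule weak_cluster_point_eq)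
  moreover have "L (A x) = W (L x)" for x
  proof -
    have "(\<lambda>N. W (?C N x) - ?C N (A x)) \<longlonglongrightarrow> 0"
    proof (rule Lim_null_comparison)
      show "(\<lambda>N. 2 * c * norm x * (1 / real (Suc N))) \<longlonglongrightarrow> 0"
        by (rule tendsto_mult_right_zero[OF LIMSEQ_Suc[OF lim_1_over_n]])
    qed (intro always_eventually allI norm_cesaro_mean_commutator_le Y A(1) c step)
    then have "(\<lambda>N. (W (?C N x) - ?C N (A x)) \<bullet> y) \<longlonglongrightarrow> 0 \<bullet> y" for y
      by (intro tendsto_inner tendsto_const)
    then have "(\<lambda>N. ?C N x \<bullet> V y - ?C N (A x) \<bullet> y) \<longlonglongrightarrow> 0" for y
      by (simp add: inner_diff_left inner_W)
    then have "L x \<bullet> V y - L (A x) \<bullet> y = 0" for y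
      by (rule weak_cluster_point_inner_diff[OF L(2)])
    then have "L (A x) \<bullet> y = W (L x) \<bullet> y" for y by (simp add: inner_W)
    then show ?thesis by (metis vector_eq_rdot)
  qed
  ultimately show ?thesis using L(1) by blast
qed

end

section \<open>Operators on complex Hilbert spaces\<close>

instance complex_hilbert \<subseteq> banach ..

lemma scaleC_of_real: "complex_of_real r *\<^sub>C x = r *\<^sub>R x"
  by (simp add: scaleC_def)

lemma scaleC_i: "\<i> *\<^sub>C x = imult x"
  by (simp add: scaleC_def)

lemma linear_imult: "linear imult"
  by (intro linearI imult_add imult_scaleR)

lemma norm_imult: "norm (imult x) = norm x"
  by (simp add: norm_eq_sqrt_inner inner_imult)

lemma inner_imult_left: "imult x \<bullet> y = - (x \<bullet> imult y)"
  using inner_imult[of "imult x" y] by (simp add: imult_imult)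

lemma cinner_eq_iff: "cinner x y = cinner u v \<longleftrightarrow> x \<bullet> y = u \<bullet> v \<and> x \<bullet> imult y = u \<bullet> imult v"
  by (simp add: cinner_def)

lemma csubspace_UNIV: "csubspace UNIV"
  by (simp add: csubspace_def)

lemma csubspace_imp_subspace: "csubspace H \<Longrightarrow> subspace H"
  unfolding csubspace_def subspace_def by (metis scaleC_of_real)

lemma csubspace_imult: "csubspace H \<Longrightarrow> x \<in> H \<Longrightarrow> imult x \<in> H"
  unfolding csubspace_def by (metis scaleC_i)

lemma bounded_op_on_in: "bounded_op_on H A \<Longrightarrow> x \<in> H \<Longrightarrow> A x \<in> H"
  by (simp add: bounded_op_on_def)

lemma bounded_op_on_add: "bounded_op_on H A \<Longrightarrow> x \<in> H \<Longrightarrow> y \<in> H \<Longrightarrow> A (x + y) = A x + A y"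
  by (simp add: bounded_op_on_def)

lemma bounded_op_on_scaleR: "bounded_op_on H A \<Longrightarrow> x \<in> H \<Longrightarrow> A (r *\<^sub>R x) = r *\<^sub>R A x"
  unfolding bounded_op_on_def by (metis scaleC_of_real)

lemma bounded_op_on_imult: "bounded_op_on H A \<Longrightarrow> x \<in> H \<Longrightarrow> A (imult x) = imult (A x)"
  unfolding bounded_op_on_def by (metis scaleC_i)

lemma bounded_op_on_compose:
  assumes A: "bounded_op_on H A" and B: "bounded_op_on H B"
  shows "bounded_op_on H (\<lambda>x. A (B x))"
proof -
  obtain c d where c: "\<And>x. x \<in> H \<Longrightarrow> norm (A x) \<le> c * norm x"
    using A unfolding bounded_op_on_def by blast
  obtain d where d: "\<And>x. x \<in> H \<Longrightarrow> norm (B x) \<le> d * norm x"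
    using B unfolding bounded_op_on_def by blast
  have "norm (A (B x)) \<le> \<bar>c\<bar> * d * norm x" if "x \<in> H" for x
  proof -
    have "norm (A (B x)) \<le> c * norm (B x)" using bounded_op_on_in[OF B that] by (rule c)
    also have "\<dots> \<le> \<bar>c\<bar> * norm (B x)" by (intro mult_right_mono) simp_all
    also have "\<dots> \<le> \<bar>c\<bar> * (d * norm x)" using that by (intro mult_left_mono d) simp_all
    finally show ?thesis by (simp add: mult.assoc)
  qed
  then have "\<exists>c. \<forall>x\<in>H. norm (A (B x)) \<le> c * norm x" by blast
  with A B show ?thesis by (simp add: bounded_op_on_def)
qed

lemma bounded_op_on_UNIV_iff:
  "bounded_op_on UNIV A \<longleftrightarrow> bounded_linear A \<and> (\<forall>x. A (imult x) = imult (A x))"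
proof
  assume A: "bounded_op_on UNIV A"
  then obtain c where "\<And>x. norm (A x) \<le> c * norm x" unfolding bounded_op_on_def by blast
  then have "bounded_linear A"
    using bounded_op_on_add[OF A] bounded_op_on_scaleR[OF A]
    by (intro bounded_linear_intro[of _ c]) (simp_all add: mult.commute)
  with A show "bounded_linear A \<and> (\<forall>x. A (imult x) = imult (A x))"
    by (simp add: bounded_op_on_imult)
next
  assume A: "bounded_linear A \<and> (\<forall>x. A (imult x) = imult (A x))"
  then interpret bounded_linear A by simp
  show "bounded_op_on UNIV A"
    using A bounded by (simp add: bounded_op_on_def scaleC_def add scaleR mult.commute)
qed

lemma contraction_on_UNIV_iff:
  "contraction_on UNIV A \<longleftrightarrow> A \<in> operator_ball 1 \<and> (\<forall>x. A (imult x) = imult (A x))"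
  by (auto simp: contraction_on_def bounded_op_on_UNIV_iff operator_ball_def)

lemma contraction_on_compose:
  assumes "contraction_on H A" "contraction_on H B"
  shows "contraction_on H (\<lambda>x. A (B x))"
  unfolding contraction_on_def
proof
  show "bounded_op_on H (\<lambda>x. A (B x))"
    using assms by (simp add: contraction_on_def bounded_op_on_compose)
  show "\<forall>x\<in>H. norm (A (B x)) \<le> norm x"
    using assms bounded_op_on_in[of H B] unfolding contraction_on_def by (blast intro: order_trans)
qed

lemma norm_le_opnorm_on_unit_ball:
  assumes A: "bounded_op_on H A" and x: "x \<in> H" "norm x \<le> 1"
  shows "norm (A x) \<le> opnorm_on H A"
  unfolding opnorm_on_def
proof (rule cSup_upper)
  obtain c where c: "\<And>y. y \<in> H \<Longrightarrow> norm (A y) \<le> c * norm y"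
    using A unfolding bounded_op_on_def by blast
  have "norm (A y) \<le> \<bar>c\<bar>" if "y \<in> H" "norm y \<le> 1" for y
  proof -
    have "c * norm y \<le> \<bar>c\<bar> * 1" using that(2) by (intro mult_mono) simp_all
    with c[OF that(1)] show ?thesis by simp
  qed
  then show "bdd_above ((\<lambda>x. norm (A x)) ` {x \<in> H. norm x \<le> 1})"
    by (intro bdd_aboveI2[of _ _ "\<bar>c\<bar>"]) simp
qed (use x in blast)

lemma norm_le_opnorm_on:
  assumes H: "csubspace H" and A: "bounded_op_on H A" and x: "x \<in> H"
  shows "norm (A x) \<le> opnorm_on H A * norm x"
proof (cases "x = 0")
  case True
  then show ?thesis using bounded_op_on_scaleR[OF A x, of 0] by simp
next
  case False
  have "x /\<^sub>R norm x \<in> H" using csubspace_imp_subspace[OF H] x by (rule subspace_scale)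
  then have "norm (A (x /\<^sub>R norm x)) \<le> opnorm_on H A"
    using False by (intro norm_le_opnorm_on_unit_ball[OF A]) simp_all
  with False show ?thesis by (simp add: bounded_op_on_scaleR[OF A x] field_simps)
qed

lemma opnorm_on_nonneg:
  assumes "csubspace H" "bounded_op_on H A"
  shows "opnorm_on H A \<ge> 0"
proof -
  have "0 \<in> H" using assms(1) by (simp add: csubspace_def)
  then have "norm (A 0) \<le> opnorm_on H A"
    using assms(2) by (intro norm_le_opnorm_on_unit_ball) simp_all
  then show ?thesis using norm_ge_zero order_trans by blast
qed

lemma opnorm_on_le:
  assumes "csubspace H" "\<And>x. x \<in> H \<Longrightarrow> norm (A x) \<le> c * norm x" "c \<ge> 0"
  shows "opnorm_on H A \<le> c"
  unfolding opnorm_on_def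
proof (rule cSup_least)
  show "(\<lambda>x. norm (A x)) ` {x \<in> H. norm x \<le> 1} \<noteq> {}"
    using assms(1) by (auto simp: csubspace_def intro!: exI[of _ 0])
next
  fix r
  assume "r \<in> (\<lambda>x. norm (A x)) ` {x \<in> H. norm x \<le> 1}"
  then obtain x where "x \<in> H" "norm x \<le> 1" "r = norm (A x)" by blast
  then show "r \<le> c" using assms(2)[of x] mult_left_mono[of "norm x" 1 c] assms(3) by simp
qed

lemma opnorm_on_extension_eq:
  assumes H: "csubspace H" and X: "bounded_op_on H X" and Y: "bounded_op_on UNIV Y"
    and YX: "extends_on H Y X" and bound: "\<And>x. norm (Y x) \<le> opnorm_on H X * norm x"
  shows "opnorm_on UNIV Y = opnorm_on H X"
proof (rule antisym)
  show "opnorm_on UNIV Y \<le> opnorm_on H X"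
    using csubspace_UNIV bound opnorm_on_nonneg[OF H X] by (rule opnorm_on_le)
  have "norm (X x) \<le> opnorm_on UNIV Y * norm x" if "x \<in> H" for x
    using norm_le_opnorm_on[OF csubspace_UNIV Y UNIV_I, of x] YX that by (simp add: extends_on_def)
  then show "opnorm_on H X \<le> opnorm_on UNIV Y"
    by (rule opnorm_on_le[OF H _ opnorm_on_nonneg[OF csubspace_UNIV Y]])
qed

section \<open>Coisometries and unitary operators\<close>

lemma coisometry_imp_real_coisometry:
  assumes "coisometry W"
  shows "\<exists>V. real_coisometry W V"
  using assms unfolding coisometry_def real_coisometry_def by (auto simp: cinner_eq_iff)

lemma coisometry_imp_contraction_on:
  assumes "coisometry W"
  shows "contraction_on UNIV W"
proof -
  obtain V where V: "bounded_op_on UNIV V" "\<And>x y. cinner (W x) y = cinner x (V y)"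
    using assms unfolding coisometry_def by blast
  obtain V' where "real_coisometry W V'" using coisometry_imp_real_coisometry[OF assms] by blast
  then have "W \<in> operator_ball 1" by (rule real_coisometry.W_in_operator_ball)
  moreover have "W (imult x) = imult (W x)" for x
  proof -
    have "W (imult x) \<bullet> y = imult (W x) \<bullet> y" for y
      using V by (simp add: cinner_eq_iff inner_imult_left bounded_op_on_imult)
    then show ?thesis by (metis vector_eq_rdot)
  qed
  ultimately show ?thesis by (simp add: contraction_on_UNIV_iff)
qed

lemma coisometry_compose:
  assumes "coisometry A" "coisometry B"
  shows "coisometry (\<lambda>x. A (B x))"
proof -
  obtain A' where "bounded_op_on UNIV A'" "\<And>x y. cinner (A x) y = cinner x (A' y)"
    "\<And>x. A (A' x) = x"
    using assms(1) unfolding coisometry_def by blast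
  moreover obtain B' where "bounded_op_on UNIV B'" "\<And>x y. cinner (B x) y = cinner x (B' y)"
    "\<And>x. B (B' x) = x"
    using assms(2) unfolding coisometry_def by blast
  ultimately show ?thesis
    unfolding coisometry_def by (intro exI[of _ "\<lambda>x. B' (A' x)"]) (simp add: bounded_op_on_compose)
qed

lemma unitary_on_UNIV_imp_bij:
  assumes "unitary_on UNIV U"
  shows "bij U"
proof -
  have "inj U"
  proof (rule injI)
    fix x y
    assume "U x = U y"
    then have "x \<bullet> z = y \<bullet> z" for z
      using assms by (metis UNIV_I cinner_eq_iff unitary_on_def)
    then show "x = y" by (metis vector_eq_rdot)
  qed
  moreover have "surj U" using assms by (simp add: unitary_on_def)
  ultimately show ?thesis by (rule bijI)
qed

lemma coisometry_inv_unitary: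
  assumes U: "unitary_on UNIV U"
  shows "coisometry (inv U)"
  unfolding coisometry_def
proof (intro exI conjI allI)
  have bij: "bij U" using U by (rule unitary_on_UNIV_imp_bij)
  show "bounded_op_on UNIV U" using U by (simp add: unitary_on_def)
  show "inv U (U x) = x" for x using bij by (simp add: bij_is_inj)
  show "cinner (inv U x) y = cinner x (U y)" for x y
  proof -
    have "cinner (inv U x) y = cinner (U (inv U x)) (U y)" using U by (simp add: unitary_on_def)
    then show ?thesis using bij by (simp add: bij_is_surj surj_f_inv_f)
  qed
qed

section \<open>Norm-preserving intertwining extensions\<close>

definition complex_average :: "('a::complex_hilbert \<Rightarrow> 'a) \<Rightarrow> 'a \<Rightarrow> 'a" where
  "complex_average Y x = (1/2) *\<^sub>R (Y x - imult (Y (imult x)))"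

lemma complex_average_imult:
  assumes "linear Y"
  shows "complex_average Y (imult x) = imult (complex_average Y x)"
  by (simp add: complex_average_def imult_imult imult_scaleR linear_diff[OF linear_imult]
      linear_neg[OF assms] linear_neg[OF linear_imult])

lemma complex_average_in_operator_ball:
  assumes Y: "Y \<in> operator_ball c"
  shows "complex_average Y \<in> operator_ball c"
proof (rule operator_ballI)
  note linear_Y = operator_ball_linear[OF Y]
  show "linear (complex_average Y)"
    by (rule linearI)
      (simp_all add: complex_average_def linear_add[OF linear_Y] linear_scale[OF linear_Y]
        imult_add imult_scaleR algebra_simps)
  show "norm (complex_average Y x) \<le> c * norm x" for x
    using norm_triangle_ineq4[of "Y x" "imult (Y (imult x))"]
      operator_ball_norm[OF Y, of x] operator_ball_norm[OF Y, of "imult x"]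
    by (simp add: complex_average_def norm_imult)
qed

lemma complex_average_eq:
  assumes "Y (imult x) = imult (Y x)"
  shows "complex_average Y x = Y x"
  by (simp add: complex_average_def assms imult_imult flip: scaleR_2)

lemma complex_average_intertwines:
  assumes A: "bounded_op_on UNIV A" and W: "bounded_op_on UNIV W" and YA: "\<And>x. Y (A x) = W (Y x)"
  shows "complex_average Y (A x) = W (complex_average Y x)"
proof -
  interpret W: bounded_linear W using W by (simp add: bounded_op_on_UNIV_iff)
  have "Y (imult (A x)) = W (Y (imult x))"
    using bounded_op_on_imult[OF A, of x] YA[of "imult x"] by simp
  then have "imult (Y (imult (A x))) = W (imult (Y (imult x)))"
    by (simp add: bounded_op_on_imult[OF W])
  then show ?thesis by (simp add: complex_average_def W.scaleR W.diff YA)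
qed

lemma bounded_op_on_extends_to_ball:
  assumes H: "hilbert_subspace H" and X: "bounded_op_on H X"
  shows "\<exists>X'\<in>operator_ball (opnorm_on H X). \<forall>x\<in>H. X' x = X x"
proof -
  have csub: "csubspace H" and sub: "subspace H" "closed H"
    using H by (simp_all add: hilbert_subspace_def csubspace_imp_subspace)
  obtain P where linear_P: "linear P" and P_in: "\<And>x. P x \<in> H"
    and P_id: "\<And>x. x \<in> H \<Longrightarrow> P x = x" and P_le: "\<And>x. P x \<bullet> P x \<le> x \<bullet> x"
    using inner.linear_projection_exists[OF sub] by blast
  have "(\<lambda>x. X (P x)) \<in> operator_ball (opnorm_on H X)"
  proof (rule operator_ballI)
    show "linear (\<lambda>x. X (P x))"
      by (rule linearI)
        (simp_all add: linear_add[OF linear_P] linear_scale[OF linear_P] P_in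
          bounded_op_on_add[OF X] bounded_op_on_scaleR[OF X])
    show "norm (X (P x)) \<le> opnorm_on H X * norm x" for x
    proof -
      have "norm (X (P x)) \<le> opnorm_on H X * norm (P x)"
        using csub X P_in by (rule norm_le_opnorm_on)
      also have "\<dots> \<le> opnorm_on H X * norm x"
        using P_le by (intro mult_left_mono opnorm_on_nonneg[OF csub X]) (simp add: norm_le)
      finally show ?thesis .
    qed
  qed
  with P_id show ?thesis by (intro bexI) auto
qed

definition norm_preserving_extension ::
  "'a::complex_hilbert set \<Rightarrow> ('a \<Rightarrow> 'a) \<Rightarrow> ('a \<Rightarrow> 'a) \<Rightarrow> bool" where
  "norm_preserving_extension H X Y \<longleftrightarrow>
     bounded_op_on UNIV Y \<and> extends_on H Y X \<and> opnorm_on UNIV Y = opnorm_on H X"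

theorem norm_preserving_intertwining_extension:
  assumes H: "hilbert_subspace H" and X: "bounded_op_on H X"
    and A: "contraction_on UNIV A" "\<And>h. h \<in> H \<Longrightarrow> A h \<in> H" and W: "coisometry W"
    and XA: "\<And>h. h \<in> H \<Longrightarrow> X (A h) = W (X h)"
  shows "\<exists>Y. norm_preserving_extension H X Y \<and> (\<forall>k. Y (A k) = W (Y k))"
proof -
  have csub: "csubspace H" and sub: "subspace H" "closed H"
    using H by (simp_all add: hilbert_subspace_def csubspace_imp_subspace)
  obtain V where "real_coisometry W V" using coisometry_imp_real_coisometry[OF W] by blast
  then interpret real_coisometry W V .
  obtain X' where X': "X' \<in> operator_ball (opnorm_on H X)" "\<And>h. h \<in> H \<Longrightarrow> X' h = X h"
    using bounded_op_on_extends_to_ball[OF H X] by blast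
  obtain Y where Y: "Y \<in> operator_ball (opnorm_on H X)" and YX: "\<And>h. h \<in> H \<Longrightarrow> Y h = X h"
    and YA: "\<And>k. Y (A k) = W (Y k)"
    using intertwining_extension[OF sub opnorm_on_nonneg[OF csub X] X'(1) _ A(2)] A XA X'(2)
    by (force simp: contraction_on_UNIV_iff)
  let ?Y = "complex_average Y"
  note avg_ball = complex_average_in_operator_ball[OF Y]
  have avg_op: "bounded_op_on UNIV ?Y"
    using avg_ball
    by (simp add: operator_ball_def bounded_op_on_UNIV_iff
        complex_average_imult[OF operator_ball_linear[OF Y]])
  have "extends_on H ?Y X"
    using csub X
    by (simp add: extends_on_def complex_average_eq YX csubspace_imult bounded_op_on_imult)
  moreover have "opnorm_on UNIV ?Y = opnorm_on H X"
    using csub X avg_op calculation operator_ball_norm[OF avg_ball] by (rule opnorm_on_extension_eq)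
  moreover have "?Y (A k) = W (?Y k)" for k
    using A(1) coisometry_imp_contraction_on[OF W] YA
    by (intro complex_average_intertwines) (simp_all add: contraction_on_def)
  ultimately show ?thesis using avg_op unfolding norm_preserving_extension_def by blast
qed

corollary norm_preserving_unitary_intertwining_extension:
  assumes H: "hilbert_subspace H" and X: "bounded_op_on H X"
    and A: "contraction_on UNIV A" "\<And>h. h \<in> H \<Longrightarrow> A h \<in> H" and W: "coisometry W"
    and U: "unitary_on UNIV U" and UXA: "\<And>h. h \<in> H \<Longrightarrow> U (X (A h)) = W (X h)"
  shows "\<exists>Y. norm_preserving_extension H X Y \<and> (\<forall>k. U (Y (A k)) = W (Y k))"
proof -
  have bij: "bij U" using U by (rule unitary_on_UNIV_imp_bij)
  have "X (A h) = inv U (W (X h))" if "h \<in> H" for h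
    using bij by (simp add: bij_is_inj flip: UXA[OF that])
  then obtain Y where "norm_preserving_extension H X Y" "\<And>k. Y (A k) = inv U (W (Y k))"
    using norm_preserving_intertwining_extension[OF H X A
        coisometry_compose[OF coisometry_inv_unitary[OF U] W]] by blast
  with bij show ?thesis by (auto simp: bij_is_surj surj_f_inv_f)
qed

section \<open>Powers of extensions\<close>

lemma proj_eq_self:
  assumes H: "csubspace H" and x: "x \<in> H"
  shows "proj H x = x"
proof -
  have "p = x" if p: "p \<in> H" "x - p \<in> orth_compl H" for p
  proof -
    have "x - p \<in> H" using csubspace_imp_subspace[OF H] x p(1) by (rule subspace_diff)
    with p(2) have "(x - p) \<bullet> (x - p) = 0"
      by (simp add: orth_compl_def cinner_def complex_eq_iff)
    then show ?thesis by simp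
  qed
  moreover have "x - x \<in> orth_compl H"
    by (simp add: orth_compl_def cinner_def complex_eq_iff linear_0[OF linear_imult])
  ultimately show ?thesis unfolding proj_def using x by (intro some_equality) auto
qed

lemma funpow_in: "(\<And>x. x \<in> H \<Longrightarrow> A x \<in> H) \<Longrightarrow> x \<in> H \<Longrightarrow> (A ^^ n) x \<in> H"
  by (induction n) simp_all

lemma extends_on_funpow:
  assumes "extends_on H S A" "\<And>x. x \<in> H \<Longrightarrow> A x \<in> H" "x \<in> H"
  shows "(S ^^ n) x = (A ^^ n) x"
  using assms by (induction n) (simp_all add: extends_on_def funpow_in)

lemma powers_eq_proj_extension_powers:
  assumes H: "csubspace H" and A: "bounded_op_on H A" "extends_on H S A"
    and B: "bounded_op_on H B" "extends_on H R B" and x: "x \<in> H"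
  shows "(A ^^ n) ((B ^^ m) x) = proj H ((S ^^ n) ((R ^^ m) x))"
  using A B x by (simp add: extends_on_funpow funpow_in bounded_op_on_in proj_eq_self[OF H])

theorem mainTheorem5:
  fixes H :: "'a::complex_hilbert set"
    and T X Q Qb W :: "'a \<Rightarrow> 'a"
  assumes H: "hilbert_subspace H"
    and T: "contraction_on H T"
    and W: "bounded_op_on UNIV W" "coisometry W" "extends_on H W T"
    and X: "bounded_op_on H X"
    and Q: "contraction_on H Q"
    and Qb: "contraction_on UNIV Qb" "reduces H Qb" "extends_on H Qb Q"
  shows
   "((\<forall>h\<in>H. X (T (Q h)) = T (X h)) \<longrightarrow>
      (\<exists>Y. bounded_op_on UNIV Y \<and> extends_on H Y X \<and>
           (\<forall>k. Y (W (Qb k)) = W (Y k)) \<and>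
           (\<forall>n m. \<forall>h\<in>H. (T ^^ n) ((X ^^ m) h) = proj H ((W ^^ n) ((Y ^^ m) h)) \<and>
                           (X ^^ n) ((T ^^ m) h) = proj H ((Y ^^ n) ((W ^^ m) h))) \<and>
           opnorm_on UNIV Y = opnorm_on H X))
  \<and> ((\<forall>h\<in>H. X (Q (T h)) = T (X h)) \<longrightarrow>
      (\<exists>Y. bounded_op_on UNIV Y \<and> extends_on H Y X \<and>
           (\<forall>k. Y (Qb (W k)) = W (Y k)) \<and>
           (\<forall>n m. \<forall>h\<in>H. (T ^^ n) ((X ^^ m) h) = proj H ((W ^^ n) ((Y ^^ m) h)) \<and>
                           (X ^^ n) ((T ^^ m) h) = proj H ((Y ^^ n) ((W ^^ m) h))) \<and>
           opnorm_on UNIV Y = opnorm_on H X))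
  \<and> (unitary_on H Q \<and> unitary_on UNIV Qb \<and> (\<forall>h\<in>H. Q (X (T h)) = T (X h)) \<longrightarrow>
      (\<exists>Y. bounded_op_on UNIV Y \<and> extends_on H Y X \<and>
           (\<forall>k. Qb (Y (W k)) = W (Y k)) \<and>
           (\<forall>n m. \<forall>h\<in>H. (T ^^ n) ((X ^^ m) h) = proj H ((W ^^ n) ((Y ^^ m) h)) \<and>
                           (X ^^ n) ((T ^^ m) h) = proj H ((Y ^^ n) ((W ^^ m) h))) \<and>
           opnorm_on UNIV Y = opnorm_on H X))"
proof -
  have csub: "csubspace H" using H by (simp add: hilbert_subspace_def)
  have T_op: "bounded_op_on H T" and Q_op: "bounded_op_on H Q"
    using T Q by (simp_all add: contraction_on_def)
  note in_H = bounded_op_on_in[OF T_op] bounded_op_on_in[OF Q_op] bounded_op_on_in[OF X]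
  have on_H: "W h = T h" "Qb h = Q h" if "h \<in> H" for h
    using that W(3) Qb(3) by (simp_all add: extends_on_def)
  note W_contr = coisometry_imp_contraction_on[OF W(2)]
  have powers: "(T ^^ n) ((X ^^ m) h) = proj H ((W ^^ n) ((Y ^^ m) h)) \<and>
      (X ^^ n) ((T ^^ m) h) = proj H ((Y ^^ n) ((W ^^ m) h))"
    if "extends_on H Y X" "h \<in> H" for Y n m h
    using that csub T_op X W(3) by (simp add: powers_eq_proj_extension_powers)
  have "\<exists>Y. norm_preserving_extension H X Y \<and> (\<forall>k. Y (W (Qb k)) = W (Y k))"
    if "\<forall>h\<in>H. X (T (Q h)) = T (X h)"
    by (rule norm_preserving_intertwining_extension[OF H X
          contraction_on_compose[OF W_contr Qb(1)] _ W(2)])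
      (simp_all add: that in_H on_H)
  moreover have "\<exists>Y. norm_preserving_extension H X Y \<and> (\<forall>k. Y (Qb (W k)) = W (Y k))"
    if "\<forall>h\<in>H. X (Q (T h)) = T (X h)"
    by (rule norm_preserving_intertwining_extension[OF H X
          contraction_on_compose[OF Qb(1) W_contr] _ W(2)])
      (simp_all add: that in_H on_H)
  moreover have "\<exists>Y. norm_preserving_extension H X Y \<and> (\<forall>k. Qb (Y (W k)) = W (Y k))"
    if "unitary_on UNIV Qb" "\<forall>h\<in>H. Q (X (T h)) = T (X h)"
    by (rule norm_preserving_unitary_intertwining_extension[OF H X W_contr _ W(2) that(1)])
      (simp_all add: that in_H on_H)
  ultimately show ?thesis
    unfolding norm_preserving_extension_def using powers by (intro conjI impI; meson)
qed

end
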